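(* There is an absolute constant $c>0$ such that for every $n$ that is a power of $4$ there exists a $2$-wise independent family $\mathcal{H}$ of functions $h:[n]\to\{-1,1\}$ with \[\mathbb{E}_{h\in\mathcal{H}}\left[\sup_{1\le t\le n}\left|h_1+h_2+\cdots+h_t\right|\right]\ \ge\ c\,\sqrt{n}\,\lg n .\]
   Context: $[n]=\{1,\dots,n\}$, $\lg$ is the base-2 logarithm, and $h_i:=h(i)$. A $k$-wise independent family from $[n]$ to $\{-1,1\}$ is a probability distribution $\mathcal{H}$ over functions $h:[n]\to\{-1,1\}$ such that for any $k$ distinct indices $i_1,\dots,i_k$, the values $h_{i_1},\dots,h_{i_k}$ are independent uniformly random signs (Rademachers). *)

theory Defs
  imports "HOL-Probability.Probability"
begin

definition sign_funs :: "nat \<Rightarrow> (nat \<Rightarrow> int) set" where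
  "sign_funs n = ({1..n} \<rightarrow>\<^sub>E {-1, 1})"

definition kwise_indep_family :: "nat \<Rightarrow> nat \<Rightarrow> (nat \<Rightarrow> int) pmf \<Rightarrow> bool" where
  "kwise_indep_family k n H \<longleftrightarrow>
     set_pmf H \<subseteq> sign_funs n \<and>
     (\<forall>I a. I \<subseteq> {1..n} \<longrightarrow> card I = k \<longrightarrow> (\<forall>i\<in>I. a i \<in> {-1, 1::int}) \<longrightarrow>
        measure_pmf.prob H {h. \<forall>i\<in>I. h i = a i} = 1 / 2 ^ k)"

definition max_prefix_sum :: "nat \<Rightarrow> (nat \<Rightarrow> int) \<Rightarrow> real" where
  "max_prefix_sum n h = Max ((\<lambda>t. \<bar>real_of_int (\<Sum>i=1..t. h i)\<bar>) ` {1..n})"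

end

theory Submission
  imports Defs
begin

text \<open>
  It suffices to find finitely many vectors \<open>v\<close> in \<open>[-1, 1]^n\<close> whose coordinates are pairwise
  orthogonal, \<open>\<Sum>v. v i * v j = 0\<close> for \<open>i \<noteq> j\<close>: choose \<open>v\<close> and a global sign uniformly
  and round every coordinate independently to a sign with mean \<open>v i\<close>. By Jensen's inequality rounding
  does not decrease the expected maximal prefix sum.

  Let \<open>n = 2^(2p+2)\<close>. For each dyadic interval \<open>J\<close> with \<open>|J| \<ge> 2^(p+2)\<close>, let \<open>\<psi>\<close> be
  the function with values \<open>+1, -1, -1, +1\<close> on the quarters of \<open>J\<close>. The row of \<open>k\<close> is the sum of
  \<open>\<plusminus>(sqrt n / |J|) \<psi>\<close> over all such \<open>J\<close> containing \<open>k\<close>, the sign being positive iff \<open>k\<close>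
  lies in the left half of \<open>J\<close>. With this sign the contribution of every \<open>J\<close> to the sum of the first \<open>k\<close>
  entries is nonnegative (a tent function of \<open>k\<close>) and of average \<open>sqrt n / 8\<close>, so that the
  \<open>p + 1\<close> scales add up to order \<open>sqrt n * lg n\<close>. Different scales are uncorrelated over \<open>k\<close>
  because the sign of the smaller interval averages to zero on it. Hence the covariance of the rows is a
  combination of the \<open>\<psi> \<psi>^T\<close>, and sign vectors that are Walsh functions across the blocks of a
  dyadic partition, times a Rademacher function, complete it to a multiple of the identity
  (the Haar decomposition).
\<close>

subsection \<open>Rounding orthogonal vectors to random signs\<close>

text \<open>Sign functions are indexed from 1, vectors from 0.\<close>

definition rounding :: "nat \<Rightarrow> (nat \<Rightarrow> real) \<Rightarrow> (nat \<Rightarrow> int) pmf" where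
  "rounding n v = Pi_pmf {1..n} undefined
     (\<lambda>i. map_pmf (\<lambda>b. if b then 1 else -1) (bernoulli_pmf ((1 + v (i - 1)) / 2)))"

lemma set_rounding: "set_pmf (rounding n v) \<subseteq> sign_funs n"
proof -
  have "set_pmf (rounding n v) \<subseteq> PiE_dflt {1..n} undefined
     (set_pmf \<circ> (\<lambda>i. map_pmf (\<lambda>b. if b then 1 else -1 :: int) (bernoulli_pmf ((1 + v (i - 1)) / 2))))"
    unfolding rounding_def by (rule set_Pi_pmf_subset') simp
  also have "\<dots> \<subseteq> sign_funs n"
    by (auto simp: PiE_dflt_def sign_funs_def PiE_def extensional_def)
  finally show ?thesis .
qed

lemma finite_set_rounding: "finite (set_pmf (rounding n v))"
  by (rule finite_subset [OF set_rounding]) (auto simp: sign_funs_def intro!: finite_PiE)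

lemma prob_rounding:
  assumes v: "\<And>i. i < n \<Longrightarrow> \<bar>v i\<bar> \<le> 1" and I: "I \<subseteq> {1..n}" and a: "\<forall>i\<in>I. a i \<in> {-1, 1}"
  shows "measure_pmf.prob (rounding n v) {h. \<forall>i\<in>I. h i = a i} =
    (\<Prod>i\<in>I. (1 + of_int (a i) * v (i - 1)) / 2)"
proof -
  define p where "p i = map_pmf (\<lambda>b. if b then 1 else -1 :: int) (bernoulli_pmf ((1 + v (i - 1)) / 2))" for i
  \<comment> \<open>Outside \<open>I\<close> nothing is required, which turns the event into a
    product over all of \<open>{1..n}\<close>.\<close>
  define B where "B i = (if i \<in> I then {a i} else UNIV)" for i
  have "{h. \<forall>i\<in>I. h i = a i} = Pi {1..n} B"
    using I by (auto simp: B_def Pi_def)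
  then have "measure_pmf.prob (rounding n v) {h. \<forall>i\<in>I. h i = a i} =
      (\<Prod>i\<in>{1..n}. measure_pmf.prob (p i) (B i))"
    unfolding rounding_def p_def by (simp only: measure_Pi_pmf_Pi finite_atLeastAtMost)
  also have "\<dots> = (\<Prod>i\<in>I. measure_pmf.prob (p i) (B i))"
    using I by (intro prod.mono_neutral_right) (auto simp: B_def)
  also have "\<dots> = (\<Prod>i\<in>I. (1 + of_int (a i) * v (i - 1)) / 2)"
  proof (intro prod.cong refl)
    fix i assume i: "i \<in> I"
    then have "i \<in> {1..n}" using I by blast
    then have "\<bar>v (i - 1)\<bar> \<le> 1" by (intro v) auto
    then have b: "0 \<le> (1 + v (i - 1)) / 2" "(1 + v (i - 1)) / 2 \<le> 1" by auto
    have "(\<lambda>b. if b then 1 else -1) -` {a i} = (if a i = 1 then {True} else {False})"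
      using a i by (auto split: if_splits)
    then have "measure_pmf.prob (p i) {a i} = pmf (bernoulli_pmf ((1 + v (i - 1)) / 2)) (a i = 1)"
      unfolding p_def measure_map_pmf by (simp add: measure_pmf_single)
    then show "measure_pmf.prob (p i) (B i) = (1 + of_int (a i) * v (i - 1)) / 2"
      using a i b by (auto simp: B_def field_simps)
  qed
  finally show ?thesis .
qed

lemma expectation_rounding_component:
  assumes "\<And>i. i < n \<Longrightarrow> \<bar>v i\<bar> \<le> 1" and i: "i \<in> {1..n}"
  shows "measure_pmf.expectation (rounding n v) (\<lambda>h. real_of_int (h i)) = v (i - 1)"
proof -
  have "i - 1 < n" using i by auto
  then have b: "0 \<le> (1 + v (i - 1)) / 2" "(1 + v (i - 1)) / 2 \<le> 1" using assms(1) [of "i - 1"] by auto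
  have "measure_pmf.expectation (rounding n v) (\<lambda>h. real_of_int (h i)) =
        measure_pmf.expectation (map_pmf (\<lambda>h. h i) (rounding n v)) real_of_int"
    by simp
  also have "\<dots> = v (i - 1)"
    unfolding rounding_def using i b by (subst Pi_pmf_component) (auto simp: field_simps)
  finally show ?thesis .
qed

lemma max_prefix_sum_ge:
  assumes "t \<le> n" "n > 0"
  shows "\<bar>real_of_int (\<Sum>i=1..t. h i)\<bar> \<le> max_prefix_sum n h"
proof (cases "t = 0")
  case True
  have "0 \<le> \<bar>real_of_int (\<Sum>i=1..n. h i)\<bar>" by simp
  also have "\<dots> \<le> max_prefix_sum n h" unfolding max_prefix_sum_def using assms by (intro Max_ge) auto
  finally show ?thesis using True by simp
next
  case False
  with assms show ?thesis unfolding max_prefix_sum_def by (intro Max_ge) auto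
qed

lemma expectation_rounding_ge:
  assumes "\<And>i. i < n \<Longrightarrow> \<bar>v i\<bar> \<le> 1" and t: "t \<le> n" "n > 0"
  shows "\<bar>\<Sum>i<t. v i\<bar> \<le> measure_pmf.expectation (rounding n v) (max_prefix_sum n)"
proof -
  note int = integrable_measure_pmf_finite [OF finite_set_rounding]
  let ?S = "\<lambda>h. real_of_int (\<Sum>i=1..t. h i)"
  have "(\<Sum>i<t. v i) = (\<Sum>i=1..t. v (i - 1))"
    by (simp add: sum.atLeast1_atMost_eq)
  also have "\<dots> = (\<Sum>i=1..t. measure_pmf.expectation (rounding n v) (\<lambda>h. real_of_int (h i)))"
    using assms by (intro sum.cong refl expectation_rounding_component [symmetric]) auto
  also have "\<dots> = measure_pmf.expectation (rounding n v) ?S"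
    unfolding of_int_sum by (intro Bochner_Integration.integral_sum [symmetric] int)
  finally have "\<bar>\<Sum>i<t. v i\<bar> = \<bar>measure_pmf.expectation (rounding n v) ?S\<bar>" by simp
  also have "\<dots> \<le> measure_pmf.expectation (rounding n v) (\<lambda>h. \<bar>?S h\<bar>)"
    by (rule integral_abs_bound)
  also have "\<dots> \<le> measure_pmf.expectation (rounding n v) (max_prefix_sum n)"
    by (intro integral_mono int max_prefix_sum_ge t)
  finally show ?thesis .
qed

text \<open>Unlike in \<open>max_prefix_sum\<close>, the empty prefix is included, which makes
  nonnegativity immediate.\<close>

definition peak :: "nat \<Rightarrow> (nat \<Rightarrow> real) \<Rightarrow> real" where
  "peak n v = Max ((\<lambda>t. \<bar>\<Sum>i<t. v i\<bar>) ` {..n})"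

lemma peak_ge: "t \<le> n \<Longrightarrow> \<bar>\<Sum>i<t. v i\<bar> \<le> peak n v"
  unfolding peak_def by (intro Max_ge) auto

lemma peak_nonneg: "0 \<le> peak n v"
  using peak_ge [of 0 n v] by simp

lemma peak_uminus: "peak n (\<lambda>i. - v i) = peak n v"
  by (simp add: peak_def sum_negf)

lemma peak_le_expectation_rounding:
  assumes "\<And>i. i < n \<Longrightarrow> \<bar>v i\<bar> \<le> 1" and "n > 0"
  shows "peak n v \<le> measure_pmf.expectation (rounding n v) (max_prefix_sum n)"
  unfolding peak_def using assms by (intro Max.boundedI) (auto intro: expectation_rounding_ge)

lemma sum_list_nth: "sum_list (map f xs) = (\<Sum>a<length xs. f (xs ! a) :: real)"
  by (simp add: sum_list_sum_nth lessThan_atLeast0)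

text \<open>Given \<open>v\<close>, two coordinates are rounded independently, so a prescribed pair
  of signs has a product probability. Averaging over \<open>v\<close> kills its linear terms by
  \<open>mean\<close> and its mixed term by \<open>orth\<close>, leaving 1/4.\<close>

lemma pairwise_family_of_orthogonal:
  fixes xs :: "(nat \<Rightarrow> real) list"
  assumes ne: "xs \<noteq> []" and n: "n > 0"
    and bound: "\<And>v i. v \<in> set xs \<Longrightarrow> i < n \<Longrightarrow> \<bar>v i\<bar> \<le> 1"
    and mean: "\<And>i. i < n \<Longrightarrow> (\<Sum>v\<leftarrow>xs. v i) = 0"
    and orth: "\<And>i j. i < n \<Longrightarrow> j < n \<Longrightarrow> i \<noteq> j \<Longrightarrow> (\<Sum>v\<leftarrow>xs. v i * v j) = 0"
  shows "\<exists>H. kwise_indep_family 2 n H \<and>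
    (\<Sum>v\<leftarrow>xs. peak n v) / length xs \<le> measure_pmf.expectation H (max_prefix_sum n)"
proof -
  define N where "N = length xs"
  have N: "N > 0" using ne by (simp add: N_def)
  define H where "H = pmf_of_set {..<N} \<bind> (\<lambda>a. rounding n (xs ! a))"
  have E: "measure_pmf.expectation H g = (\<Sum>v\<leftarrow>xs. measure_pmf.expectation (rounding n v) g) / N"
    for g :: "_ \<Rightarrow> real"
    unfolding H_def sum_list_nth N_def [symmetric] using N
    by (subst pmf_expectation_bind_pmf_of_set)
       (auto simp: finite_set_rounding sum_distrib_left divide_inverse mult.commute)
  have "kwise_indep_family 2 n H"
    unfolding kwise_indep_family_def
  proof (intro conjI allI impI)
    show "set_pmf H \<subseteq> sign_funs n" using set_rounding by (auto simp: H_def)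
    fix I and a :: "nat \<Rightarrow> int"
    assume I: "I \<subseteq> {1..n}" "card I = 2" and a: "\<forall>i\<in>I. a i \<in> {-1, 1}"
    from I(2) obtain i j where ij: "I = {i, j}" "i \<noteq> j" by (auto simp: card_2_iff)
    define A where "A = real_of_int (a i)"
    define B where "B = real_of_int (a j)"
    have lt: "i - 1 < n" "j - 1 < n" "i - 1 \<noteq> j - 1" using I ij by auto
    have "measure_pmf.prob H {h. \<forall>i\<in>I. h i = a i} =
          (\<Sum>v\<leftarrow>xs. measure_pmf.prob (rounding n v) {h. \<forall>i\<in>I. h i = a i}) / N"
      using E [of "indicator {h. \<forall>i\<in>I. h i = a i}"] by simp
    also have "\<dots> = (\<Sum>v\<leftarrow>xs. (1 + A * v (i - 1)) / 2 * ((1 + B * v (j - 1)) / 2)) / N"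
      using bound I(1) a ij by (intro arg_cong2 [where f = "(/)"] arg_cong [where f = sum_list] map_cong refl)
        (subst prob_rounding, auto simp: A_def B_def)
    also have "(\<Sum>v\<leftarrow>xs. (1 + A * v (i - 1)) / 2 * ((1 + B * v (j - 1)) / 2)) =
        (\<Sum>v\<leftarrow>xs. 1 / 4 + (A / 4) * v (i - 1) + (B / 4) * v (j - 1) + (A * B / 4) * (v (i - 1) * v (j - 1)))"
      by (intro arg_cong [where f = sum_list] map_cong refl) (simp add: field_simps)
    also have "\<dots> = N / 4"
      using mean [OF lt(1)] mean [OF lt(2)] orth [OF lt]
      unfolding sum_list_addf sum_list_const_mult by (simp add: sum_list_triv N_def)
    finally show "measure_pmf.prob H {h. \<forall>i\<in>I. h i = a i} = 1 / 2 ^ 2" using N by simp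
  qed
  moreover have "(\<Sum>v\<leftarrow>xs. peak n v) / length xs \<le> measure_pmf.expectation H (max_prefix_sum n)"
    unfolding E N_def [symmetric]
    using bound n by (intro divide_right_mono sum_list_mono peak_le_expectation_rounding) auto
  ultimately show ?thesis by blast
qed

subsection \<open>Rademacher, Haar and Walsh functions\<close>

text \<open>The sign given by binary digit \<open>l\<close>. Hence
  \<open>rad (Suc l) * rad l\<close> is +1, -1, -1, +1 on the quarters of each dyadic interval of
  length \<open>2 ^ (l + 2)\<close>: the function \<psi>.\<close>

definition rad :: "nat \<Rightarrow> nat \<Rightarrow> real" where
  "rad l i = (if even (i div 2 ^ l) then 1 else -1)"

definition same :: "nat \<Rightarrow> nat \<Rightarrow> nat \<Rightarrow> real" where
  "same l i j = of_bool (i div 2 ^ l = j div 2 ^ l)"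

text \<open>An entry of Sylvester's Hadamard matrix: the parity sign of the number of common ones
  among the lowest \<open>p\<close> binary digits of \<open>a\<close> and \<open>i\<close>.\<close>

fun walsh :: "nat \<Rightarrow> nat \<Rightarrow> nat \<Rightarrow> real" where
  "walsh 0 a i = 1"
| "walsh (Suc p) a i = walsh p (a div 2) (i div 2) * (if odd a \<and> odd i then -1 else 1)"

lemma rad_square [simp]: "rad l i * rad l i = 1"
  and abs_rad [simp]: "\<bar>rad l i\<bar> = 1"
  by (auto simp: rad_def)

lemma abs_walsh [simp]: "\<bar>walsh p a i\<bar> = 1"
  by (induction p arbitrary: a i) (auto simp: abs_mult)

lemma sum_pairs: "(\<Sum>k<2 * q. f k) = (\<Sum>a<q. f (2 * a) + f (2 * a + 1 :: nat) :: real)"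
  by (induction q) auto

lemma sum_div: "s > 0 \<Longrightarrow> (\<Sum>k<q * s. f (k div s)) = real s * (\<Sum>a<q. f (a::nat))"
proof -
  assume s: "s > 0"
  have "(\<Sum>k<q * s. f (k div s)) = (\<Sum>a<q. \<Sum>k = a * s..<a * s + s. f (k div s))"
    by (rule sum.nat_group [symmetric])
  also have "\<dots> = (\<Sum>a<q. \<Sum>k = a * s..<a * s + s. f a)"
    using s by (intro sum.cong refl arg_cong [where f = f] div_nat_eqI) (auto simp: algebra_simps)
  finally show ?thesis by (simp add: sum_distrib_left)
qed

text \<open>Summing over the last digit of \<open>a\<close> gives the factor
  \<open>1 + s i * s j\<close>, which is 2 or 0 as the last digits of \<open>i\<close> and
  \<open>j\<close> agree or not; induction treats the other digits.\<close>

lemma walsh_orthogonal: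
  assumes "i < 2 ^ p" "j < 2 ^ p"
  shows "(\<Sum>a<2 ^ p. walsh p a i * walsh p a j) = 2 ^ p * of_bool (i = j)"
  using assms
proof (induction p arbitrary: i j)
  case (Suc p)
  define s where "s i = (if odd i then -1 else 1 :: real)" for i :: nat
  have "(\<Sum>a<2 ^ Suc p. walsh (Suc p) a i * walsh (Suc p) a j) =
        (\<Sum>a<2 ^ p. walsh p a (i div 2) * walsh p a (j div 2)) * (1 + s i * s j)"
    unfolding power_Suc sum_pairs sum_distrib_right
    by (intro sum.cong) (auto simp: s_def algebra_simps)
  also have "\<dots> = 2 ^ p * of_bool (i div 2 = j div 2) * (1 + s i * s j)"
    using Suc by (subst Suc.IH) auto
  also have "\<dots> = 2 ^ Suc p * of_bool (i = j)"
    by (auto simp: s_def) presburger+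
  finally show ?case .
qed auto

lemma same_split: "same l i j = same (Suc l) i j * (1 + rad l i * rad l j) / 2"
proof -
  have *: "x div 2 ^ Suc l = x div 2 ^ l div 2" for x :: nat
    by (metis div_mult2_eq power_Suc2)
  have "a = b \<longleftrightarrow> a div 2 = b div 2 \<and> (even a \<longleftrightarrow> even b)" for a b :: nat
    by presburger
  from this [of "i div 2 ^ l" "j div 2 ^ l"] show ?thesis
    unfolding same_def rad_def * by auto
qed

text \<open>Telescoping of \<open>same_split\<close>, starting from \<open>same 0\<close>, which is
  equality. Up to the factor \<open>2 ^ M\<close>, the summands are the Haar projection kernels by
  scale, and the remainder projects onto functions constant on blocks of length
  \<open>2 ^ L\<close>.\<close>

lemma haar_identity:
  "(\<Sum>l<L. 2 ^ M / 2 ^ Suc l * (same (Suc l) i j * rad l i * rad l j)) + 2 ^ M / 2 ^ L * same L i j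
     = 2 ^ M * of_bool (i = j)"
proof (induction L)
  case 0 show ?case by (simp add: same_def)
next
  case (Suc L)
  then show ?case unfolding same_split [of L] by (simp add: field_simps)
qed

text \<open>On each block of length \<open>2 ^ Suc l\<close> the factor \<open>g\<close> is constant
  while \<open>rad l\<close> is balanced.\<close>

lemma sum_rad_block:
  assumes "Suc l \<le> M"
  shows "(\<Sum>k<2 ^ M. rad l k * g (k div 2 ^ Suc l)) = 0"
proof -
  obtain d where M: "M = Suc l + d" using assms le_Suc_ex by blast
  define f where "f a = (if even a then 1 else -1) * g (a div 2)" for a :: nat
  have "(\<Sum>k<2 ^ M. rad l k * g (k div 2 ^ Suc l)) = (\<Sum>k<(2 * 2 ^ d) * 2 ^ l. f (k div 2 ^ l))"
    by (intro sum.cong) (auto simp: rad_def f_def M power_add mult_ac simp flip: div_mult2_eq)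
  also have "\<dots> = 2 ^ l * (\<Sum>a<2 * 2 ^ d. f a)"
    by (subst sum_div) auto
  also have "(\<Sum>a<2 * 2 ^ d. f a) = 0"
    unfolding sum_pairs by (auto simp: f_def)
  finally show ?thesis by simp
qed

lemma sum_same_same:
  assumes "l \<le> M" "i < 2 ^ M"
  shows "(\<Sum>k<2 ^ M. same l k i * same l k j) = 2 ^ l * same l i j"
proof -
  obtain d where M: "M = l + d" using assms le_Suc_ex by blast
  define f :: "nat \<Rightarrow> real" where "f a = of_bool (a = i div 2 ^ l) * of_bool (a = j div 2 ^ l)" for a
  have "(\<Sum>k<2 ^ M. same l k i * same l k j) = (\<Sum>k<2 ^ d * 2 ^ l. f (k div 2 ^ l))"
    by (intro sum.cong) (auto simp: same_def f_def M power_add)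
  also have "\<dots> = 2 ^ l * (\<Sum>a<2 ^ d. f a)"
    by (subst sum_div) auto
  also have "(\<Sum>a<2 ^ d. f a) = (\<Sum>a<2 ^ d. if a = i div 2 ^ l then same l i j else 0)"
    by (intro sum.cong) (auto simp: f_def same_def)
  also have "\<dots> = same l i j"
    using assms by (simp add: M power_add less_mult_imp_div_less mult.commute)
  finally show ?thesis .
qed

text \<open>As functions of \<open>k\<close> the factors are unnormalised Haar functions of the
  intervals around \<open>i\<close> and \<open>j\<close>. At unequal scales the coarser one is
  constant on the support of the finer one, which has mean zero.\<close>

lemma haar_orthogonal:
  assumes "l < M" "l' < M" "i < 2 ^ M" "j < 2 ^ M"
  shows "(\<Sum>k<2 ^ M. (same (Suc l) k i * rad l k) * (same (Suc l') k j * rad l' k)) =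
         of_bool (l = l') * (2 ^ Suc l * same (Suc l) i j)"
proof -
  have zero: "(\<Sum>k<2 ^ M. (same (Suc l) k i * rad l k) * (same (Suc l') k j * rad l' k)) = 0"
    if "l < l'" "l < M" for l l' i j
  proof -
    obtain d where d: "l' = Suc l + d" using \<open>l < l'\<close> less_iff_Suc_add by auto
    define g :: "nat \<Rightarrow> real" where "g a = of_bool (a = i div 2 ^ Suc l) *
       (of_bool (a div 2 ^ Suc d = j div 2 ^ Suc l') * (if even (a div 2 ^ d) then 1 else -1))" for a
    have "(same (Suc l) k i * rad l k) * (same (Suc l') k j * rad l' k) = rad l k * g (k div 2 ^ Suc l)" for k
      by (simp only: same_def g_def rad_def d div_mult2_eq [symmetric] power_add [symmetric]
          add_Suc add_Suc_right mult_ac add.commute [of d l])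
    then show ?thesis using sum_rad_block [of l M g] that by (simp only: Suc_le_eq)
  qed
  consider "l < l'" | "l' < l" | "l = l'" by linarith
  then show ?thesis
  proof cases
    case 1 then show ?thesis using zero assms by simp
  next
    case 2
    then show ?thesis using zero [of l' l j i] assms by (simp add: mult_ac)
  next
    case 3
    have "(same (Suc l) k i * rad l k) * (same (Suc l) k j * rad l k) = same (Suc l) k i * same (Suc l) k j" for k
      by (simp add: rad_def)
    then show ?thesis using 3 sum_same_same [of "Suc l" M i j] assms by (simp only: Suc_le_eq) simp
  qed
qed

section \<open>Tent functions as prefix sums of products of Rademacher functions\<close>

definition tent :: "nat \<Rightarrow> nat \<Rightarrow> real" where
  "tent q w = real (min w (2 * q - w))"

lemma sum_tent: "(\<Sum>w<2 * q. tent q w) = real q ^ 2"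
proof -
  have "(\<Sum>w<2 * q. tent q w) = (\<Sum>w<q. tent q w) + (\<Sum>w<q. tent q (q + w))"
    using sum.nat_group [of "tent q" q 2] sum.atLeastLessThan_concat [of 0 q "2 * q" "tent q"]
      sum.shift_bounds_nat_ivl [of "tent q" 0 q q]
    by (simp add: lessThan_atLeast0 mult_2 add.commute)
  also have "\<dots> = (\<Sum>w<q. real q)"
    unfolding sum.distrib [symmetric] by (intro sum.cong) (auto simp: tent_def min_def)
  finally show ?thesis by (simp add: power2_eq_square)
qed

text \<open>Within a block of length \<open>2 ^ Suc l\<close> the sign \<open>rad (Suc l)\<close> is
  fixed and \<open>rad l\<close> is the slope of the tent. At the end of the block the tent is 0, so
  the change of sign causes no jump.\<close>

lemma tent_step:
  "rad (Suc l) (Suc k) * tent (2 ^ l) (Suc k mod 2 ^ Suc l) =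
   rad (Suc l) k * tent (2 ^ l) (k mod 2 ^ Suc l) + rad (Suc l) k * rad l k"
proof -
  define q :: nat where "q = 2 ^ l"
  define a where "a = k div (2 * q)"
  define w where "w = k mod (2 * q)"
  have q: "q > 0" by (simp add: q_def)
  have k: "k = 2 * q * a + w" by (simp add: a_def w_def)
  have w: "w < 2 * q" using q by (simp add: w_def)
  have r1: "rad (Suc l) x = (if even (x div (2 * q)) then 1 else -1)" for x by (simp add: rad_def q_def)
  have kq: "k div q = 2 * a + w div q"
    using q div_mult_self2 [of q w "2 * a"] by (simp add: k algebra_simps)
  have r0: "rad l k = (if w < q then 1 else -1)"
  proof (cases "w < q")
    case False
    then have "w div q = 1" using w by (intro div_nat_eqI) auto
    with False kq show ?thesis by (simp add: rad_def q_def)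
  qed (use kq in \<open>simp add: rad_def q_def\<close>)
  show ?thesis
  proof (cases "Suc w < 2 * q")
    case True
    have "Suc k div (2 * q) = a" "Suc k mod (2 * q) = Suc w"
      using True q by (simp_all add: k del: mult_Suc_right flip: add_Suc_right)
    then show ?thesis using True unfolding r1 r0 a_def [symmetric]
      by (auto simp: tent_def w_def [symmetric] q_def [symmetric] min_def)
  next
    case False
    then have ww: "Suc w = 2 * q" using w by simp
    have "Suc k = 2 * q * Suc a" using k ww by simp
    then have "Suc k mod (2 * q) = 0" by simp
    moreover have "2 * q - w = 1" "1 \<le> w" "\<not> w < q" using ww q by linarith+
    then have "tent q w = 1" "tent q 0 = 0" "\<not> w < q" by (simp_all add: tent_def)
    ultimately show ?thesis using ww unfolding r1 r0 a_def [symmetric]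
      by (auto simp: w_def [symmetric] q_def [symmetric])
  qed
qed

lemma sum_rad_rad: "(\<Sum>i<k. rad (Suc l) i * rad l i) = rad (Suc l) k * tent (2 ^ l) (k mod 2 ^ Suc l)"
  by (induction k) (simp_all add: tent_step del: power_Suc, simp add: tent_def)

text \<open>The unrestricted prefix sum vanishes at multiples of \<open>2 ^ Suc l\<close>, in
  particular at the start \<open>b\<close> of the block of \<open>k\<close>, so restricting the sum
  to that block changes nothing.\<close>

lemma prefix_block:
  "(\<Sum>i<k. same (l + 2) k i * (rad (Suc l) i * rad l i)) = rad (Suc l) k * tent (2 ^ l) (k mod 2 ^ Suc l)"
proof -
  define s :: nat where "s = 2 ^ (l + 2)"
  define b where "b = k div s * s"
  have s: "s > 0" by (simp add: s_def)
  have b: "b \<le> k" by (simp add: b_def)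
  have "2 ^ Suc l dvd b" by (auto simp: b_def s_def intro!: dvd_mult)
  then have b0: "(\<Sum>i<b. rad (Suc l) i * rad l i) = 0"
    unfolding sum_rad_rad by (simp add: tent_def del: power_Suc)
  have "(\<Sum>i<k. same (l + 2) k i * (rad (Suc l) i * rad l i)) =
        (\<Sum>i<b. same (l + 2) k i * (rad (Suc l) i * rad l i)) +
        (\<Sum>i=b..<k. same (l + 2) k i * (rad (Suc l) i * rad l i))"
    using b by (simp add: lessThan_atLeast0 sum.atLeastLessThan_concat)
  also have "(\<Sum>i<b. same (l + 2) k i * (rad (Suc l) i * rad l i)) = 0"
  proof (intro sum.neutral ballI)
    fix i assume "i \<in> {..<b}"
    then have "i div s < k div s" using s by (simp add: b_def less_mult_imp_div_less)
    then show "same (l + 2) k i * (rad (Suc l) i * rad l i) = 0" by (simp add: same_def s_def)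
  qed
  also have "(\<Sum>i=b..<k. same (l + 2) k i * (rad (Suc l) i * rad l i)) = (\<Sum>i=b..<k. rad (Suc l) i * rad l i)"
  proof (intro sum.cong refl)
    fix i assume i: "i \<in> {b..<k}"
    have "i div s = k div s"
      using i s by (intro div_nat_eqI) (auto simp: b_def mult.commute intro: less_trans [OF _ dividend_less_times_div])
    then show "same (l + 2) k i * (rad (Suc l) i * rad l i) = rad (Suc l) i * rad l i" by (simp add: same_def s_def)
  qed
  also have "\<dots> = (\<Sum>i<k. rad (Suc l) i * rad l i)"
    using b b0 by (simp add: lessThan_atLeast0 sum.atLeastLessThan_concat [of 0 b k, symmetric])
  finally show ?thesis by (simp only: sum_rad_rad)
qed

lemma sum_tent_mod:
  assumes "Suc l \<le> M"
  shows "(\<Sum>k<2 ^ M. tent (2 ^ l) (k mod 2 ^ Suc l)) = 2 ^ M * 2 ^ l / 2"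
proof -
  obtain d where M: "M = Suc l + d" using assms le_Suc_ex by blast
  define s :: nat where "s = 2 * 2 ^ l"
  have "(\<Sum>k<2 ^ M. tent (2 ^ l) (k mod 2 ^ Suc l)) = (\<Sum>k<2 ^ d * s. tent (2 ^ l) (k mod s))"
    by (simp add: M power_add s_def mult_ac)
  also have "\<dots> = (\<Sum>a<2 ^ d. \<Sum>k = a * s..<a * s + s. tent (2 ^ l) (k mod s))"
    by (rule sum.nat_group [symmetric])
  also have "\<dots> = (\<Sum>a<(2::nat) ^ d. \<Sum>w<s. tent (2 ^ l) w)"
  proof (rule sum.cong [OF refl])
    fix a :: nat
    show "(\<Sum>k = a * s..<a * s + s. tent (2 ^ l) (k mod s)) = (\<Sum>w<s. tent (2 ^ l) w)"
      using sum.shift_bounds_nat_ivl [of "\<lambda>k. tent (2 ^ l) (k mod s)" 0 "a * s" s]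
      by (simp add: lessThan_atLeast0 add.commute)
  qed
  also have "\<dots> = 2 ^ M * 2 ^ l / 2"
    unfolding s_def sum_tent by (simp add: M power_add power2_eq_square)
  finally show ?thesis .
qed

subsection \<open>The rows and their orthogonal complement\<close>

text \<open>Index \<open>l\<close> stands for the intervals of length \<open>2 ^ (l + 2)\<close>,
  and the weight is sqrt n over that length, with \<open>n = 2 ^ (2 * p + 2)\<close>. Starting at
  \<open>l = p\<close> makes the weights 1/2, 1/4, ..., so entries stay in [-1, 1].\<close>

definition row :: "nat \<Rightarrow> nat \<Rightarrow> nat \<Rightarrow> real" where
  "row p k i = (\<Sum>l=p..2 * p. 2 ^ p / 2 ^ Suc l *
     (same (l + 2) k i * rad (Suc l) k * (rad (Suc l) i * rad l i)))"

lemma sum_row_weights: "(\<Sum>l=p..p + d. 2 ^ p / 2 ^ Suc l) = 1 - 2 ^ p / (2 ^ Suc (p + d) :: real)"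
  by (induction d) (auto simp: field_simps)

lemma abs_row_le: "\<bar>row p k i\<bar> \<le> 1"
proof -
  have "\<bar>row p k i\<bar> \<le> (\<Sum>l=p..2 * p. 2 ^ p / 2 ^ Suc l)"
    unfolding row_def
    by (rule order_trans [OF sum_abs], rule sum_mono) (auto simp: abs_mult same_def)
  also have "\<dots> \<le> 1"
    using sum_row_weights [of p p] by (simp flip: mult_2)
  finally show ?thesis .
qed

lemma row_covariance:
  assumes "i < 2 ^ (2 * p + 2)" "j < 2 ^ (2 * p + 2)"
  shows "(\<Sum>k<2 ^ (2 * p + 2). row p k i * row p k j) =
    (\<Sum>l=p..2 * p. 2 ^ (2 * p + 2) / 2 ^ (l + 2) *
       (same (l + 2) i j * (rad (Suc l) i * rad (Suc l) j) * (rad l i * rad l j)))"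
proof -
  define g where "g l i = 2 ^ p / 2 ^ Suc l * (rad (Suc l) i * rad l i)" for l i
  define h where "h l k i = same (Suc (Suc l)) k i * rad (Suc l) k" for l k i
  have row: "row p k i = (\<Sum>l=p..2 * p. g l i * h l k i)" for k i
    by (simp add: row_def g_def h_def mult_ac)
  have "(\<Sum>k<2 ^ (2 * p + 2). row p k i * row p k j) =
      (\<Sum>k<2 ^ (2 * p + 2). \<Sum>l=p..2 * p. \<Sum>l'=p..2 * p. (g l i * h l k i) * (g l' j * h l' k j))"
    by (simp only: row sum_product)
  also have "\<dots> = (\<Sum>l=p..2 * p. \<Sum>k<2 ^ (2 * p + 2). \<Sum>l'=p..2 * p. (g l i * h l k i) * (g l' j * h l' k j))"
    by (rule sum.swap)
  also have "\<dots> = (\<Sum>l=p..2 * p. \<Sum>l'=p..2 * p. \<Sum>k<2 ^ (2 * p + 2). (g l i * h l k i) * (g l' j * h l' k j))"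
    by (rule sum.cong [OF refl sum.swap])
  also have "\<dots> = (\<Sum>l=p..2 * p. \<Sum>l'=p..2 * p. g l i * g l' j * (\<Sum>k<2 ^ (2 * p + 2). h l k i * h l' k j))"
    unfolding sum_distrib_left by (simp only: mult_ac)
  also have "\<dots> = (\<Sum>l=p..2 * p. \<Sum>l'=p..2 * p.
     if l = l' then g l i * g l j * (2 ^ (l + 2) * same (l + 2) i j) else 0)"
    unfolding h_def
    by (intro sum.cong refl, subst haar_orthogonal) (use assms in auto)
  also have "\<dots> = (\<Sum>l=p..2 * p. g l i * g l j * (2 ^ (l + 2) * same (l + 2) i j))"
    by (intro sum.cong refl) simp
  \<comment> \<open>The squared weight times the block length \<open>2 ^ (l + 2)\<close> is n
    divided by the block length, the coefficient that \<open>blocks\<close> also produces.\<close>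
  also have "\<dots> = (\<Sum>l=p..2 * p. 2 ^ (2 * p + 2) / 2 ^ (l + 2) *
       (same (l + 2) i j * (rad (Suc l) i * rad (Suc l) j) * (rad l i * rad l j)))"
    by (intro sum.cong refl) (simp add: g_def field_simps power_add power_mult power2_eq_square)
  finally show ?thesis .
qed

section \<open>Completing the rows by Walsh blocks\<close>

definition blocks :: "nat \<Rightarrow> nat \<Rightarrow> (nat \<Rightarrow> real) \<Rightarrow> (nat \<Rightarrow> real) list" where
  "blocks M l w = map (\<lambda>a i. walsh (M - l) a (i div 2 ^ l) * w i) [0..<2 ^ (M - l)]"

text \<open>Orthogonality of the Walsh functions in the block index kills pairs from different
  blocks; within a block the Walsh factors cancel and each vector contributes
  \<open>w i * w j\<close>.\<close>

lemma blocks_covariance: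
  assumes "l \<le> M" "i < 2 ^ M" "j < 2 ^ M"
  shows "(\<Sum>v\<leftarrow>blocks M l w. v i * v j) = 2 ^ M / 2 ^ l * (same l i j * (w i * w j))"
proof -
  obtain d where M: "M = l + d" using assms le_Suc_ex by blast
  have lt: "i div 2 ^ l < 2 ^ d" "j div 2 ^ l < 2 ^ d"
    using assms by (simp_all add: M power_add less_mult_imp_div_less mult.commute)
  have "(\<Sum>v\<leftarrow>blocks M l w. v i * v j) =
        (\<Sum>a<2 ^ d. walsh d a (i div 2 ^ l) * walsh d a (j div 2 ^ l)) * (w i * w j)"
    by (simp add: blocks_def M o_def interv_sum_list_conv_sum_set_nat lessThan_atLeast0
        sum_distrib_left mult_ac)
  also have "\<dots> = 2 ^ M / 2 ^ l * (same l i j * (w i * w j))"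
    using walsh_orthogonal [OF lt] by (simp add: M power_add same_def)
  finally show ?thesis .
qed

text \<open>For \<open>l\<close> from \<open>p\<close> to \<open>2 * p\<close>,
  \<open>same_split\<close> cuts the Haar kernel into a part with the factor
  \<open>rad (Suc l) i * rad (Suc l) j\<close>, supplied by the rows, and a part without it,
  supplied by the first group. The second group gives the finer kernels, the last one the remainder
  in \<open>haar_identity\<close>.\<close>

definition complement :: "nat \<Rightarrow> (nat \<Rightarrow> real) list" where
  "complement p =
     concat (map (\<lambda>l. blocks (2 * p + 2) (l + 2) (rad l)) [p..<Suc (2 * p)]) @
     concat (map (\<lambda>l. blocks (2 * p + 2) (Suc l) (rad l)) [0..<p]) @
     blocks (2 * p + 2) (Suc (2 * p)) (\<lambda>_. 1)"

lemma abs_complement: "v \<in> set (complement p) \<Longrightarrow> \<bar>v i\<bar> = 1"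
  by (auto simp: complement_def blocks_def abs_mult)

lemma sum_list_concat_upt:
  "(\<Sum>v\<leftarrow>concat (map F [a..<b]). f v) = (\<Sum>l=a..<b. \<Sum>v\<leftarrow>F l. f v :: real)"
  by (induction b) (auto simp: sum.atLeastLessThan_Suc)

lemma system_covariance:
  assumes "i < 2 ^ (2 * p + 2)" "j < 2 ^ (2 * p + 2)"
  shows "(\<Sum>v\<leftarrow>map (row p) [0..<2 ^ (2 * p + 2)] @ complement p. v i * v j) =
    2 ^ (2 * p + 2) * of_bool (i = j)"
proof -
  define M where "M = 2 * p + 2"
  define e where "e l = 2 ^ M / 2 ^ Suc l * (same (Suc l) i j * rad l i * rad l j)" for l
  have "(\<Sum>v\<leftarrow>complement p. v i * v j) =
     (\<Sum>l=p..2 * p. 2 ^ M / 2 ^ (l + 2) * (same (l + 2) i j * (rad l i * rad l j))) +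
     (\<Sum>l<p. e l) + 2 ^ M / 2 ^ Suc (2 * p) * same (Suc (2 * p)) i j"
    using assms unfolding complement_def map_append sum_list_append sum_list_concat_upt M_def [symmetric]
    by (simp add: blocks_covariance e_def M_def atLeastLessThanSuc_atLeastAtMost lessThan_atLeast0
        mult.assoc del: power_Suc)
  moreover have "(\<Sum>v\<leftarrow>map (row p) [0..<2 ^ M]. v i * v j) =
     (\<Sum>l=p..2 * p. 2 ^ M / 2 ^ (l + 2) *
       (same (l + 2) i j * (rad (Suc l) i * rad (Suc l) j) * (rad l i * rad l j)))"
    using row_covariance [OF assms]
    by (simp add: M_def o_def interv_sum_list_conv_sum_set_nat lessThan_atLeast0 del: power_Suc)
  moreover have "2 ^ M / 2 ^ (l + 2) * (same (l + 2) i j * (rad (Suc l) i * rad (Suc l) j) * (rad l i * rad l j)) +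
      2 ^ M / 2 ^ (l + 2) * (same (l + 2) i j * (rad l i * rad l j)) = e l" for l
    unfolding e_def same_split [of "Suc l"] by (simp add: field_simps)
  ultimately have "(\<Sum>v\<leftarrow>map (row p) [0..<2 ^ M] @ complement p. v i * v j) =
     (\<Sum>l=p..2 * p. e l) + (\<Sum>l<p. e l) + 2 ^ M / 2 ^ Suc (2 * p) * same (Suc (2 * p)) i j"
    by (simp add: sum.distrib [symmetric] del: power_Suc)
  also have "(\<Sum>l=p..2 * p. e l) + (\<Sum>l<p. e l) = (\<Sum>l<Suc (2 * p). e l)"
    using sum.atLeastLessThan_concat [of 0 p "Suc (2 * p)" e]
    by (simp add: lessThan_atLeast0 atLeastLessThanSuc_atLeastAtMost)
  finally show ?thesis
    using haar_identity [where L = "Suc (2 * p)" and M = M and i = i and j = j] by (simp add: e_def M_def)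
qed

text \<open>The vectors of the complement are sign vectors, so their number is a diagonal entry of their covariance.\<close>

lemma length_complement_le: "real (length (complement p)) \<le> 2 ^ (2 * p + 2)"
proof -
  have sq: "v 0 * v 0 = 1" if "v \<in> set (complement p)" for v
    using abs_complement [OF that, of 0] by (metis abs_mult_self_eq mult_1)
  have "real (length (complement p)) = (\<Sum>v\<leftarrow>complement p. v 0 * v 0)"
    by (simp add: sq sum_list_triv cong: map_cong)
  also have "\<dots> \<le> (\<Sum>v\<leftarrow>map (row p) [0..<2 ^ (2 * p + 2)] @ complement p. v 0 * v 0)"
    unfolding map_append sum_list_append by (auto intro!: sum_list_nonneg simp del: upt_Suc)
  also have "\<dots> = 2 ^ (2 * p + 2)"
    by (subst system_covariance) auto
  finally show ?thesis .
qed

text \<open>The sign \<open>rad (Suc l) k\<close> built into the row meets the same sign in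
  \<open>prefix_block\<close> and squares away.\<close>

lemma row_prefix: "(\<Sum>i<k. row p k i) = (\<Sum>l=p..2 * p. 2 ^ p / 2 ^ Suc l * tent (2 ^ l) (k mod 2 ^ Suc l))"
proof -
  have "(\<Sum>i<k. row p k i) = (\<Sum>l=p..2 * p. 2 ^ p / 2 ^ Suc l *
     (rad (Suc l) k * (\<Sum>i<k. same (l + 2) k i * (rad (Suc l) i * rad l i))))"
    unfolding row_def by (subst sum.swap) (simp add: sum_distrib_left mult_ac)
  also have "\<dots> = (\<Sum>l=p..2 * p. 2 ^ p / 2 ^ Suc l * tent (2 ^ l) (k mod 2 ^ Suc l))"
    unfolding prefix_block by (simp add: mult.assoc [symmetric] del: power_Suc)
  finally show ?thesis .
qed

text \<open>Row \<open>k\<close> is cut at its own index \<open>k\<close>. Weight and tent height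
  balance, so each of the \<open>p + 1\<close> scales contributes \<open>2 ^ p / 4\<close> on
  average over \<open>k\<close>.\<close>

lemma sum_peak_row_ge:
  "(real p + 1) * 2 ^ p * 2 ^ (2 * p + 2) / 4 \<le> (\<Sum>k<2 ^ (2 * p + 2). peak (2 ^ (2 * p + 2)) (row p k))"
proof -
  have "(\<Sum>k<2 ^ (2 * p + 2). \<Sum>i<k. row p k i) =
    (\<Sum>l=p..2 * p. 2 ^ p / 2 ^ Suc l * (\<Sum>k<2 ^ (2 * p + 2). tent (2 ^ l) (k mod 2 ^ Suc l)))"
    unfolding row_prefix sum_distrib_left by (rule sum.swap)
  also have "\<dots> = (\<Sum>l=p..2 * p. 2 ^ p / 2 ^ Suc l * (2 ^ (2 * p + 2) * 2 ^ l / 2))"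
    by (intro sum.cong refl, subst sum_tent_mod) auto
  also have "\<dots> = (\<Sum>l=p..2 * p. 2 ^ p * 2 ^ (2 * p + 2) / 4)"
    by (intro sum.cong refl) (simp add: field_simps)
  finally have "(real p + 1) * 2 ^ p * 2 ^ (2 * p + 2) / 4 = (\<Sum>k<2 ^ (2 * p + 2). \<Sum>i<k. row p k i)"
    by simp
  also have "\<dots> \<le> (\<Sum>k<2 ^ (2 * p + 2). peak (2 ^ (2 * p + 2)) (row p k))"
    by (intro sum_mono order_trans [OF abs_ge_self peak_ge]) auto
  finally show ?thesis .
qed

section \<open>Assembling the family\<close>

lemma pairwise_family_exists:
  fixes p :: nat
  defines "n \<equiv> 2 ^ (2 * p + 2)"
  shows "\<exists>H. kwise_indep_family 2 n H \<and>
    measure_pmf.expectation H (max_prefix_sum n) \<ge> (real p + 1) * 2 ^ p / 8"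
proof -
  define ys where "ys = map (row p) [0..<n] @ complement p"
  \<comment> \<open>Adjoining the negatives forces mean zero and keeps pairwise products and
    peaks.\<close>
  define xs where "xs = ys @ map (\<lambda>v i. - v i) ys"
  have bound: "\<bar>v i\<bar> \<le> 1" if "v \<in> set xs" for v i
    using that by (auto simp: xs_def ys_def abs_row_le abs_complement)
  have "\<exists>H. kwise_indep_family 2 n H \<and>
    (\<Sum>v\<leftarrow>xs. peak n v) / length xs \<le> measure_pmf.expectation H (max_prefix_sum n)"
  proof (rule pairwise_family_of_orthogonal)
    show "xs \<noteq> []" by (simp add: xs_def ys_def n_def)
    show "n > 0" by (simp add: n_def)
    show "(\<Sum>v\<leftarrow>xs. v i) = 0" for i
      by (simp add: xs_def o_def uminus_sum_list_map [unfolded o_def, symmetric])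
    show "(\<Sum>v\<leftarrow>xs. v i * v j) = 0" if "i < n" "j < n" "i \<noteq> j" for i j
      using system_covariance [of i p j] that by (simp add: xs_def ys_def n_def o_def)
  qed (use bound in auto)
  moreover have "(real p + 1) * 2 ^ p / 8 \<le> (\<Sum>v\<leftarrow>xs. peak n v) / length xs"
  proof -
    have "0 < length ys" by (simp add: ys_def n_def)
    \<comment> \<open>At most \<open>n\<close> further vectors join the \<open>n\<close> rows, so
      the average peak loses a factor of at most 2: 1/4 becomes 1/8.\<close>
    have len: "real (length ys) \<le> 2 * real n"
      using length_complement_le [of p] by (simp add: ys_def n_def)
    have "(real p + 1) * 2 ^ p * real n / 4 \<le> (\<Sum>k<n. peak n (row p k))"
      using sum_peak_row_ge [of p] by (simp add: n_def)
    also have "\<dots> \<le> (\<Sum>v\<leftarrow>ys. peak n v)"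
      by (auto simp: ys_def o_def interv_sum_list_conv_sum_set_nat lessThan_atLeast0
          intro!: sum_list_nonneg peak_nonneg)
    finally have S: "(real p + 1) * 2 ^ p * real n / 4 \<le> (\<Sum>v\<leftarrow>ys. peak n v)" .
    have "(real p + 1) * 2 ^ p / 8 * real (length ys) \<le> (real p + 1) * 2 ^ p / 8 * (2 * real n)"
      by (intro mult_left_mono len) simp
    also have "\<dots> \<le> (\<Sum>v\<leftarrow>ys. peak n v)" using S by (simp add: mult_ac)
    finally have "(real p + 1) * 2 ^ p / 8 \<le> (\<Sum>v\<leftarrow>ys. peak n v) / length ys"
      using \<open>0 < length ys\<close> by (simp add: pos_le_divide_eq)
    also have "\<dots> = (\<Sum>v\<leftarrow>xs. peak n v) / length xs"
      by (simp add: xs_def o_def peak_uminus)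
    finally show ?thesis .
  qed
  ultimately show ?thesis by (meson order_trans)
qed

theorem theorem1:
  shows "\<exists>c::real. c > 0 \<and>
    (\<forall>n::nat. (\<exists>m::nat. n = 4 ^ m) \<longrightarrow>
      (\<exists>H. kwise_indep_family 2 n H \<and>
           measure_pmf.expectation H (max_prefix_sum n) \<ge> c * sqrt (real n) * log 2 (real n)))"
\<comment> \<open>For \<open>n = 4 ^ (p + 1)\<close>, sqrt n times lg n is
  \<open>4 * (p + 1) * 2 ^ p\<close>, so 1/32 yields the bound with 1/8.\<close>
proof (intro exI [of _ "1 / 32"] conjI allI impI)
  fix n :: nat
  assume "\<exists>m. n = 4 ^ m"
  then obtain m where n: "n = 4 ^ m" by blast
  show "\<exists>H. kwise_indep_family 2 n H \<and>
           measure_pmf.expectation H (max_prefix_sum n) \<ge> 1 / 32 * sqrt (real n) * log 2 (real n)"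
  proof (cases m)
    case 0
    \<comment> \<open>For \<open>n = 1\<close> the logarithm is 0 and \<open>{1}\<close> has no
      two-element subset, so a point mass suffices.\<close>
    have "kwise_indep_family 2 1 (return_pmf (\<lambda>i\<in>{1..1}. 1))"
      using card_mono [of "{1::nat}"] by (fastforce simp: kwise_indep_family_def sign_funs_def)
    moreover have "max_prefix_sum 1 h \<ge> 0" for h
      using max_prefix_sum_ge [of 0 1 h] by simp
    ultimately show ?thesis using 0 n by auto
  next
    case (Suc p)
    have n': "n = 2 ^ (2 * p + 2)" by (simp add: n Suc power_mult)
    have "real n = (2 ^ (p + 1))\<^sup>2" by (simp add: n' power_mult [symmetric] algebra_simps)
    then have "sqrt (real n) = 2 ^ (p + 1)" by (simp only: real_sqrt_abs abs_power_minus) simp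
    moreover have "log 2 (real n) = 2 * p + 2" using log_nat_power [of 2 2 "2 * p + 2"] by (simp add: n')
    ultimately have "1 / 32 * sqrt (real n) * log 2 (real n) = (real p + 1) * 2 ^ p / 8" by (simp add: field_simps)
    then show ?thesis using pairwise_family_exists [of p] unfolding n' by simp
  qed
qed simp

end
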